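(* Let $R$ be a finite non-commutative ring with unity. Let $A=\{a_1,a_2,\dots,a_m\}$ and $B=\{b_1,b_2,\dots,b_n\}$ be generating sets for $R$. If $A\cap Z(R)=\{a_{c+1},\dots,a_m\}$ and $B\cap Z(R)=\{b_{d+1},\dots,b_n\}$, then $D=\{a_1,a_2,\dots,a_c,b_1,b_2,\dots,b_d\}$ is a dominating set for the non-commuting graph $\Gamma_R$.
   Context: Rings are associative. For a ring $R$, $Z(R)=\{x\in R : xr=rx \text{ for all } r\in R\}$ is its center. The non-commuting graph $\Gamma_R$ of a finite ring $R$ is the simple undirected graph with vertex set $V(\Gamma_R)=R\setminus Z(R)$ in which two distinct vertices $a,b$ are adjacent if and only if $ab\neq ba$. A generating set for $R$ is a subset generating $R$ as a ring with unity (every element of $R$ is a $\mathbb{Z}$-linear combination of finite products, including the empty product $1$, of elements of the set). The elements listed in $A$ are distinct, and likewise those listed in $B$; thus $a_1,\dots,a_c$ are the non-central elements of $A$ and $b_1,\dots,b_d$ are the non-central elements of $B$. A dominating set of $\Gamma_R$ is a subset $D$ of $V(\Gamma_R)$ such that every vertex in $V(\Gamma_R)\setminus D$ is adjacent to at least one member of $D$. *)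

theory Defs
  imports "HOL-Algebra.Generated_Rings" "Graph_Theory.Pair_Digraph"
begin

definition ring_center :: "('a, 'b) ring_scheme \<Rightarrow> 'a set" where
  "ring_center R =
     {x \<in> carrier R. \<forall>r \<in> carrier R. x \<otimes>\<^bsub>R\<^esub> r = r \<otimes>\<^bsub>R\<^esub> x}"

definition ring_generating_set :: "('a, 'b) ring_scheme \<Rightarrow> 'a set \<Rightarrow> bool" where
  "ring_generating_set R S \<longleftrightarrow> S \<subseteq> carrier R \<and> generate_ring R S = carrier R"

text \<open>The subring with unity generated by \<open>S\<close> is the set of integer linear combinations
  of finite products of elements of \<open>S\<close>, the empty product being the unit; that is, the
  additive subgroup generated by these products.\<close>

lemma (in ring) generate_ring_eq_span_products:
  assumes S: "S \<subseteq> carrier R"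
  shows "generate_ring R S =
    generate (add_monoid R) {foldr (\<otimes>) w \<one> | w. set w \<subseteq> S}" (is "_ = generate _ ?W")
proof -
  have prod_closed: "foldr (\<otimes>) w \<one> \<in> carrier R" if "set w \<subseteq> S" for w
    using that S by (induction w) auto
  then have W: "?W \<subseteq> carrier (add_monoid R)" by auto
  have span_closed: "x \<in> carrier R" if "x \<in> generate (add_monoid R) ?W" for x
    using add.generate_in_carrier W that by auto
  have prod_append: "foldr (\<otimes>) (v @ w) \<one> = foldr (\<otimes>) v \<one> \<otimes> foldr (\<otimes>) w \<one>"
    if "set v \<subseteq> S" "set w \<subseteq> S" for v w
    using that
  proof (induction v)
    case Nil
    then show ?case using prod_closed by simp
  next
    case (Cons a v)
    then have "a \<in> carrier R" using S by auto
    then show ?case using Cons prod_closed[of v] prod_closed[of w] by (simp add: m_assoc)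
  qed
  have neg: "\<ominus> x \<in> generate (add_monoid R) ?W" if "x \<in> generate (add_monoid R) ?W" for x
    using add.generate_m_inv_closed[OF _ that] W by (simp add: a_inv_def)
  have add: "x \<oplus> y \<in> generate (add_monoid R) ?W"
    if "x \<in> generate (add_monoid R) ?W" "y \<in> generate (add_monoid R) ?W" for x y
    using generate.eng[OF that] by simp
  have zero: "\<zero> \<in> generate (add_monoid R) ?W"
    using generate.one[of "add_monoid R" ?W] by simp
  have mult_word: "x \<otimes> y \<in> generate (add_monoid R) ?W"
    if x: "x \<in> ?W" and y: "y \<in> generate (add_monoid R) ?W" for x y
    using y
  proof (induction y rule: generate.induct)
    case one
    then show ?case using x prod_closed zero by auto
  next
    case (incl h)
    obtain v w where vw: "set v \<subseteq> S" "set w \<subseteq> S"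
      and xh: "x = foldr (\<otimes>) v \<one>" "h = foldr (\<otimes>) w \<one>"
      using x incl by blast
    have "x \<otimes> h = foldr (\<otimes>) (v @ w) \<one>" using prod_append[OF vw] xh by simp
    then have "x \<otimes> h \<in> ?W" using vw by (metis (mono_tags, lifting) Un_least mem_Collect_eq set_append)
    then show ?case by (rule generate.incl)
  next
    case (inv h)
    obtain v w where vw: "set v \<subseteq> S" "set w \<subseteq> S"
      and xh: "x = foldr (\<otimes>) v \<one>" "h = foldr (\<otimes>) w \<one>"
      using x inv by blast
    have "x \<otimes> h = foldr (\<otimes>) (v @ w) \<one>" using prod_append[OF vw] xh by simp
    then have "x \<otimes> h \<in> ?W" using vw by (metis (mono_tags, lifting) Un_least mem_Collect_eq set_append)
    then have "\<ominus> (x \<otimes> h) \<in> generate (add_monoid R) ?W" by (intro neg generate.incl)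
    moreover have "x \<in> carrier R" "h \<in> carrier R" using vw xh prod_closed by auto
    ultimately show ?case by (simp add: r_minus a_inv_def[symmetric])
  next
    case (eng h1 h2)
    have "x \<in> carrier R" using x prod_closed by auto
    then show ?case using eng span_closed[of h1] span_closed[of h2] add by (simp add: r_distr)
  qed
  have mult: "x \<otimes> y \<in> generate (add_monoid R) ?W"
    if x: "x \<in> generate (add_monoid R) ?W" and y: "y \<in> generate (add_monoid R) ?W" for x y
    using x
  proof (induction x rule: generate.induct)
    case one
    then show ?case using span_closed[OF y] zero by simp
  next
    case (incl h)
    then show ?case using mult_word y by blast
  next
    case (inv h)
    then have "h \<in> carrier R" using prod_closed by auto
    then show ?case using neg[OF mult_word[OF inv y]] span_closed[OF y]
      by (simp add: l_minus a_inv_def[symmetric])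
  next
    case (eng h1 h2)
    then show ?case using span_closed[OF y] span_closed[of h1] span_closed[of h2] add
      by (simp add: l_distr)
  qed
  show ?thesis
  proof (intro equalityI subsetI)
    fix x assume "x \<in> generate_ring R S"
    then show "x \<in> generate (add_monoid R) ?W"
    proof (induction x rule: generate_ring.induct)
      case one
      have "foldr (\<otimes>) [] \<one> \<in> ?W" by (metis (mono_tags, lifting) empty_subsetI list.set(1) mem_Collect_eq)
      then show ?case using generate.incl[of \<one> ?W "add_monoid R"] by simp
    next
      case (incl h)
      have "foldr (\<otimes>) [h] \<one> \<in> ?W" using incl by (intro CollectI exI[of _ "[h]"]) simp
      then show ?case using generate.incl[of h ?W "add_monoid R"] incl S by (simp add: subset_eq)
    qed (auto intro: neg add mult)
  next
    fix x assume "x \<in> generate (add_monoid R) ?W"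
    then show "x \<in> generate_ring R S"
    proof (induction x rule: generate.induct)
      case one
      then show ?case using zero_in_generate by simp
    next
      case (incl h)
      then obtain w where w: "set w \<subseteq> S" "h = foldr (\<otimes>) w \<one>" by blast
      have "foldr (\<otimes>) w \<one> \<in> generate_ring R S" using w(1)
        by (induction w) (auto intro: generate_ring.intros)
      then show ?case using w by simp
    next
      case (inv h)
      then obtain w where w: "set w \<subseteq> S" "h = foldr (\<otimes>) w \<one>" by blast
      have "foldr (\<otimes>) w \<one> \<in> generate_ring R S" using w(1)
        by (induction w) (auto intro: generate_ring.intros)
      then show ?case using w generate_ring.a_inv[of h R S] by (simp add: a_inv_def)
    qed (auto intro: generate_ring.intros)
  qed
qed

text \<open>An undirected edge is represented by its two orientations.\<close>

definition non_commuting_graph :: "('a, 'b) ring_scheme \<Rightarrow> 'a pair_pre_digraph" where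
  "non_commuting_graph R =
     \<lparr>pverts = carrier R - ring_center R,
      parcs = {(x, y). x \<in> carrier R - ring_center R \<and> y \<in> carrier R - ring_center R \<and>
                       x \<noteq> y \<and> x \<otimes>\<^bsub>R\<^esub> y \<noteq> y \<otimes>\<^bsub>R\<^esub> x}\<rparr>"

lemma pair_graph_non_commuting_graph:
  assumes "finite (carrier R)"
  shows "pair_graph (non_commuting_graph R)"
proof unfold_locales
  show "finite (parcs (non_commuting_graph R))"
    by (rule finite_subset[of _ "carrier R \<times> carrier R"])
       (use assms in \<open>auto simp: non_commuting_graph_def\<close>)
qed (use assms in \<open>auto simp: non_commuting_graph_def symmetric_def sym_def\<close>)

definition dominating_set :: "'a pair_pre_digraph \<Rightarrow> 'a set \<Rightarrow> bool" where
  "dominating_set G D \<longleftrightarrow>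
     D \<subseteq> pverts G \<and> (\<forall>v \<in> pverts G - D. \<exists>u \<in> D. u \<rightarrow>\<^bsub>with_proj G\<^esub> v)"

end

theory Submission
  imports Defs
begin

text \<open>The centralizer of an element \<open>v\<close> is a subring. If \<open>v\<close> commutes with every non-central
  element of a generating set, then it commutes with the whole generating set, because the
  remaining generators are central; hence its centralizer is the whole ring and \<open>v\<close> is central.
  Contrapositively, every vertex of the non-commuting graph fails to commute with some
  non-central generator, so the non-central part of any generating set dominates the graph.
  Domination survives adding vertices, which gives the union of two such sets.\<close>

lemma (in ring) commutes_with_generate_ring:
  assumes v: "v \<in> carrier R"
    and S: "S \<subseteq> carrier R"
    and comm: "\<And>s. s \<in> S \<Longrightarrow> v \<otimes> s = s \<otimes> v"
    and x: "x \<in> generate_ring R S"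
  shows "v \<otimes> x = x \<otimes> v"
  using x
proof (induction x rule: generate_ring.induct)
  case one
  then show ?case using v by simp
next
  case (incl h)
  then show ?case by (rule comm)
next
  case (a_inv h)
  have "h \<in> carrier R" using a_inv generate_ring_in_carrier[OF S] by blast
  then show ?case using a_inv v by (simp add: l_minus r_minus)
next
  case (eng_add h1 h2)
  have "h1 \<in> carrier R" "h2 \<in> carrier R"
    using eng_add generate_ring_in_carrier[OF S] by blast+
  then show ?case using eng_add v by (simp add: l_distr r_distr)
next
  case (eng_mult h1 h2)
  have h: "h1 \<in> carrier R" "h2 \<in> carrier R"
    using eng_mult generate_ring_in_carrier[OF S] by blast+
  have "v \<otimes> (h1 \<otimes> h2) = (h1 \<otimes> v) \<otimes> h2"
    using h v eng_mult by (simp add: m_assoc[symmetric])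
  also have "\<dots> = (h1 \<otimes> h2) \<otimes> v"
    using h v eng_mult by (simp add: m_assoc)
  finally show ?case .
qed

text \<open>A generator that fails to commute with a vertex \<open>v\<close> is non-central, since \<open>v\<close> witnesses
  this, so only the existence of such a generator is at stake. If there were none, the
  centralizer of \<open>v\<close> would contain the generated subring, that is, the whole ring.\<close>

lemma (in ring) dominating_set_noncentral_generators:
  assumes gen: "ring_generating_set R S"
  shows "dominating_set (non_commuting_graph R) (S - ring_center R)"
  unfolding dominating_set_def
proof (intro conjI ballI)
  have S: "S \<subseteq> carrier R" and span: "generate_ring R S = carrier R"
    using gen by (auto simp: ring_generating_set_def)
  show "S - ring_center R \<subseteq> pverts (non_commuting_graph R)"
    using S by (auto simp: non_commuting_graph_def)
  fix v assume "v \<in> pverts (non_commuting_graph R) - (S - ring_center R)"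
  then have v: "v \<in> carrier R" "v \<notin> ring_center R" "v \<notin> S"
    by (auto simp: non_commuting_graph_def)
  have "\<exists>s \<in> S. v \<otimes> s \<noteq> s \<otimes> v"
  proof (rule ccontr)
    assume "\<not> (\<exists>s \<in> S. v \<otimes> s \<noteq> s \<otimes> v)"
    then have "v \<otimes> x = x \<otimes> v" if "x \<in> carrier R" for x
      using commutes_with_generate_ring[OF v(1) S] that span by blast
    then show False using v by (simp add: ring_center_def)
  qed
  then obtain s where s: "s \<in> S" "v \<otimes> s \<noteq> s \<otimes> v" by blast
  then have "s \<notin> ring_center R" using v(1) unfolding ring_center_def by force
  moreover have "s \<noteq> v" using s v(3) by blast
  ultimately have "s \<rightarrow>\<^bsub>with_proj (non_commuting_graph R)\<^esub> v"
    using s S v by (auto simp: non_commuting_graph_def)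
  then show "\<exists>u \<in> S - ring_center R. u \<rightarrow>\<^bsub>with_proj (non_commuting_graph R)\<^esub> v"
    using s(1) \<open>s \<notin> ring_center R\<close> by blast
qed

lemma dominating_set_Un:
  assumes "dominating_set G D" and "dominating_set G E"
  shows "dominating_set G (D \<union> E)"
  using assms unfolding dominating_set_def by blast

text \<open>Injectivity matters: a repeated value could be listed both before and after position
  \<open>k\<close>, and would then be a central element among the first \<open>k\<close>.\<close>

lemma image_initial_segment_eq_Diff:
  fixes f :: "nat \<Rightarrow> 'a"
  assumes "inj_on f {1..m}" and "k \<le> m" and "f ` {1..m} \<inter> Z = f ` {k+1..m}"
  shows "f ` {1..k} = f ` {1..m} - Z"
proof -
  have "f ` {1..m} - Z = f ` {1..m} - f ` {k+1..m}"
    using assms(3) by blast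
  also have "\<dots> = f ` ({1..m} - {k+1..m})"
    using inj_on_image_set_diff[OF assms(1), of "{1..m}" "{k+1..m}"] by auto
  also have "{1..m} - {k+1..m} = {1..k}" using assms(2) by auto
  finally show ?thesis by simp
qed

theorem proposition2p5:
  fixes R :: "('a, 'r) ring_scheme"
    and a b :: "nat \<Rightarrow> 'a"
    and m n c d :: nat
  assumes "ring R"
    and "finite (carrier R)"
    and "\<not> cring R"
    and "inj_on a {1..m}"
    and "inj_on b {1..n}"
    and "ring_generating_set R (a ` {1..m})"
    and "ring_generating_set R (b ` {1..n})"
    and "c \<le> m"
    and "d \<le> n"
    and "a ` {1..m} \<inter> ring_center R = a ` {c+1..m}"
    and "b ` {1..n} \<inter> ring_center R = b ` {d+1..n}"
  shows "dominating_set (non_commuting_graph R) (a ` {1..c} \<union> b ` {1..d})"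
proof -
  interpret ring R by fact
  have "a ` {1..c} = a ` {1..m} - ring_center R"
    using assms by (intro image_initial_segment_eq_Diff)
  moreover have "b ` {1..d} = b ` {1..n} - ring_center R"
    using assms by (intro image_initial_segment_eq_Diff)
  ultimately show ?thesis
    using assms by (simp add: dominating_set_Un dominating_set_noncentral_generators)
qed

end
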